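(* Let $f:\mathbb{R}\to\mathbb{R}$ be continuous with $\lim_{|x|\to\infty} f(x)/x=0$, let $k=(k(n))_{n\ge 0}$ be a real sequence with $\sum_{j=0}^\infty |k(j)|<+\infty$, let $(H(n))_{n\ge 1}$ be a real sequence, let $\xi\in\mathbb{R}$, and let $(x(n))_{n\ge 0}$ be the real sequence defined by $x(0)=\xi$ and $$x(n+1)=H(n+1)+\sum_{j=0}^n k(n-j)f(x(j)),\quad n\ge 0.$$ Let $H^*(n)=\max_{1\le j\le n}|H(j)|$ for $n\geq 1$ and $x^*(n)=\max_{0\le j\le n}|x(j)|$ for $n\ge 0$. Then: (a) If $\lim_{n\to\infty}H^*(n)\in[0,\infty)$, then $\lim_{n\to\infty}x^*(n)\in[0,\infty)$. (b) If $\lim_{n\to\infty}H^*(n)=+\infty$, then $\lim_{n\to\infty}x^*(n)=+\infty$. *)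

theory Defs
  imports Complex_Main
begin

(* Only used for n \<ge> m; for n < m this is the unspecified Max of the empty set. *)
definition running_max_abs :: "nat \<Rightarrow> (nat \<Rightarrow> real) \<Rightarrow> nat \<Rightarrow> real" where
  "running_max_abs m u n = (MAX j\<in>{m..n}. \<bar>u j\<bar>)"

end

theory Submission
  imports Defs
begin

text \<open>
  A running maximum of absolute values is nondecreasing, so it either converges or tends to
  infinity, according to whether the sequence is bounded (\<open>running_max_abs_converges_iff\<close>,
  \<open>running_max_abs_at_top_iff\<close>). The theorem therefore says that \<open>x\<close> is bounded if and
  only if \<open>H\<close> is.

  Let \<open>K = (\<Sum>j. \<bar>k j\<bar>)\<close>. A convolution with \<open>k\<close> enlarges a uniform bound at most by the factor
  \<open>K\<close> (\<open>abs_convolution_le\<close>). If \<open>x\<close> is bounded, then so is \<open>f \<circ> x\<close>, hence so is its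
  convolution with \<open>k\<close>, and \<open>H\<close> is the difference of two bounded sequences. Conversely,
  sublinearity gives \<open>\<bar>f y\<bar> \<le> M + \<epsilon> * \<bar>y\<bar>\<close> for every \<open>\<epsilon> > 0\<close>
  (\<open>sublinear_affine_bound\<close>). With \<open>\<epsilon>\<close> so small that \<open>\<epsilon> * K \<le> 1 / 2\<close>, a bound \<open>A\<close> on
  \<open>H\<close> gives \<open>\<bar>x (n + 1)\<bar> \<le> A + M * K + x\<^sup>*(n) / 2\<close>, and a recursion that contracts the past
  by the factor one half cannot leave the ball of radius
  \<open>max \<bar>x 0\<bar> (2 * (A + M * K))\<close>.
\<close>

section \<open>Running maxima and boundedness\<close>

lemma abs_le_running_max_abs:
  assumes "m \<le> j" "j \<le> n"
  shows "\<bar>u j\<bar> \<le> running_max_abs m u n"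
  unfolding running_max_abs_def using assms by (intro Max_ge) auto

lemma running_max_abs_le_iff:
  assumes "m \<le> n"
  shows "running_max_abs m u n \<le> B \<longleftrightarrow> (\<forall>j\<in>{m..n}. \<bar>u j\<bar> \<le> B)"
  unfolding running_max_abs_def using assms by (subst Max_le_iff) auto

lemma running_max_abs_mono:
  assumes "m \<le> n" "n \<le> p"
  shows "running_max_abs m u n \<le> running_max_abs m u p"
  using assms by (subst running_max_abs_le_iff) (auto intro: abs_le_running_max_abs)

lemma running_max_abs_converges_iff:
  "(\<exists>L\<in>{0..}. running_max_abs m u \<longlonglongrightarrow> L) \<longleftrightarrow> (\<exists>B. \<forall>n\<ge>m. \<bar>u n\<bar> \<le> B)"
proof
  assume "\<exists>L\<in>{0..}. running_max_abs m u \<longlonglongrightarrow> L"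
  then have "Bseq (running_max_abs m u)"
    using convergentI convergent_imp_Bseq by blast
  then obtain B where B: "\<And>n. norm (running_max_abs m u n) \<le> B"
    by (meson BseqE)
  have "\<bar>u n\<bar> \<le> B" if "m \<le> n" for n
    using abs_le_running_max_abs[OF that order_refl, of u] B[of n] by auto
  then show "\<exists>B. \<forall>n\<ge>m. \<bar>u n\<bar> \<le> B" by blast
next
  assume "\<exists>B. \<forall>n\<ge>m. \<bar>u n\<bar> \<le> B"
  then obtain B where B: "\<And>n. m \<le> n \<Longrightarrow> \<bar>u n\<bar> \<le> B" by blast
  \<comment> \<open>Below index \<open>m\<close> the running maximum is a maximum over the empty set, so monotone
    convergence applies only to the shifted sequence.\<close>
  let ?v = "\<lambda>n. running_max_abs m u (n + m)"
  have "incseq ?v"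
    by (intro monoI running_max_abs_mono) auto
  moreover have "\<forall>n. ?v n \<le> B"
    using B by (simp add: running_max_abs_le_iff)
  ultimately obtain L where L: "?v \<longlonglongrightarrow> L" and ge: "\<forall>n. ?v n \<le> L"
    using incseq_convergent by blast
  have "0 \<le> \<bar>u m\<bar>" by simp
  also have "\<bar>u m\<bar> \<le> ?v 0" by (simp add: abs_le_running_max_abs)
  also have "\<dots> \<le> L" using ge by blast
  finally have "L \<in> {0..}" by simp
  moreover have "running_max_abs m u \<longlonglongrightarrow> L"
    using L by (rule LIMSEQ_offset)
  ultimately show "\<exists>L\<in>{0..}. running_max_abs m u \<longlonglongrightarrow> L" by blast
qed

lemma running_max_abs_at_top_iff:
  "filterlim (running_max_abs m u) at_top sequentially \<longleftrightarrow> \<not> (\<exists>B. \<forall>n\<ge>m. \<bar>u n\<bar> \<le> B)"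
proof
  assume lim: "filterlim (running_max_abs m u) at_top sequentially"
  show "\<not> (\<exists>B. \<forall>n\<ge>m. \<bar>u n\<bar> \<le> B)"
  proof
    assume "\<exists>B. \<forall>n\<ge>m. \<bar>u n\<bar> \<le> B"
    then obtain B where B: "\<And>n. m \<le> n \<Longrightarrow> \<bar>u n\<bar> \<le> B" by blast
    have "eventually (\<lambda>n. B < running_max_abs m u n \<and> m \<le> n) sequentially"
      using lim by (intro eventually_conj eventually_ge_at_top) (simp add: filterlim_at_top_dense)
    then obtain n where "B < running_max_abs m u n" "m \<le> n"
      by (auto dest: eventually_happens)
    moreover from \<open>m \<le> n\<close> have "running_max_abs m u n \<le> B"
      using B by (simp add: running_max_abs_le_iff)
    ultimately show False by simp
  qed
next
  assume unbounded: "\<not> (\<exists>B. \<forall>n\<ge>m. \<bar>u n\<bar> \<le> B)"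
  show "filterlim (running_max_abs m u) at_top sequentially"
    unfolding filterlim_at_top
  proof
    fix B
    from unbounded obtain p where p: "m \<le> p" "B \<le> \<bar>u p\<bar>"
      by (meson linear)
    have "B \<le> running_max_abs m u n" if "p \<le> n" for n
      using p abs_le_running_max_abs[OF p(1) that, of u] by linarith
    then show "eventually (\<lambda>n. B \<le> running_max_abs m u n) sequentially"
      by (auto simp: eventually_sequentially)
  qed
qed

section \<open>Bounds for convolutions and sublinear functions\<close>

lemma abs_convolution_le:
  fixes k g :: "nat \<Rightarrow> real"
  assumes "summable (\<lambda>j. \<bar>k j\<bar>)" and g: "\<And>j. j \<le> n \<Longrightarrow> \<bar>g j\<bar> \<le> G"
  shows "\<bar>\<Sum>j=0..n. k (n - j) * g j\<bar> \<le> (\<Sum>j. \<bar>k j\<bar>) * G"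
proof -
  have "0 \<le> G" using g[of 0] by linarith
  have "\<bar>\<Sum>j=0..n. k (n - j) * g j\<bar> \<le> (\<Sum>j=0..n. \<bar>k (n - j)\<bar> * G)"
    using g by (intro order_trans[OF sum_abs] sum_mono) (auto simp: abs_mult intro: mult_left_mono)
  also have "\<dots> = (\<Sum>j\<le>n. \<bar>k (n - j)\<bar>) * G"
    by (simp add: sum_distrib_right atLeast0AtMost)
  also have "(\<Sum>j\<le>n. \<bar>k (n - j)\<bar>) = (\<Sum>j\<le>n. \<bar>k j\<bar>)"
    by (rule sum.reindex_bij_witness[of _ "\<lambda>j. n - j" "\<lambda>j. n - j"]) auto
  also have "(\<Sum>j\<le>n. \<bar>k j\<bar>) * G \<le> (\<Sum>j. \<bar>k j\<bar>) * G"
    using assms(1) \<open>0 \<le> G\<close> by (intro mult_right_mono sum_le_suminf) auto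
  finally show ?thesis .
qed

lemma continuous_bounded_on_interval:
  fixes f :: "real \<Rightarrow> real"
  assumes "continuous_on UNIV f"
  obtains M where "0 \<le> M" "\<And>y. \<bar>y\<bar> \<le> B \<Longrightarrow> \<bar>f y\<bar> \<le> M"
proof -
  let ?I = "{- \<bar>B\<bar>..\<bar>B\<bar>}"
  have "continuous_on ?I (\<lambda>y. \<bar>f y\<bar>)"
    using assms by (intro continuous_intros) (auto intro: continuous_on_subset)
  then obtain z where z: "\<forall>y\<in>?I. \<bar>f y\<bar> \<le> \<bar>f z\<bar>"
    using continuous_attains_sup[of ?I "\<lambda>y. \<bar>f y\<bar>"] by auto
  show thesis
  proof (rule that[of "\<bar>f z\<bar>"])
    fix y assume "\<bar>y\<bar> \<le> B"
    then have "y \<in> ?I" by auto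
    with z show "\<bar>f y\<bar> \<le> \<bar>f z\<bar>" by blast
  qed simp
qed

text \<open>
  Near infinity the slope \<open>f y / y\<close> is at most \<open>\<epsilon>\<close>; on the remaining compact interval
  continuity supplies the constant term.
\<close>

lemma sublinear_affine_bound:
  fixes f :: "real \<Rightarrow> real"
  assumes "continuous_on UNIV f" "((\<lambda>y. f y / y) \<longlongrightarrow> 0) at_infinity" "0 < \<epsilon>"
  obtains M where "0 \<le> M" "\<And>y. \<bar>f y\<bar> \<le> M + \<epsilon> * \<bar>y\<bar>"
proof -
  have "eventually (\<lambda>y. \<bar>f y / y\<bar> < \<epsilon>) at_infinity"
    using tendstoD[OF assms(2,3)] by simp
  then obtain b where b: "\<And>y. b \<le> \<bar>y\<bar> \<Longrightarrow> \<bar>f y / y\<bar> < \<epsilon>"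
    by (auto simp: eventually_at_infinity)
  \<comment> \<open>The interval has to contain 0, where \<open>f y / y\<close> carries no information on \<open>f\<close>.\<close>
  obtain M where M: "0 \<le> M" "\<And>y. \<bar>y\<bar> \<le> max b 0 \<Longrightarrow> \<bar>f y\<bar> \<le> M"
    using continuous_bounded_on_interval[OF assms(1), of "max b 0"] by blast
  have "\<bar>f y\<bar> \<le> M + \<epsilon> * \<bar>y\<bar>" for y
  proof (cases "\<bar>y\<bar> \<le> max b 0")
    case True
    have "0 \<le> \<epsilon> * \<bar>y\<bar>" using assms(3) by simp
    with M(2)[OF True] show ?thesis by linarith
  next
    case False
    then have "0 < \<bar>y\<bar>" "\<bar>f y / y\<bar> < \<epsilon>" using b by auto
    then have "\<bar>f y\<bar> < \<epsilon> * \<bar>y\<bar>" by (simp add: abs_divide pos_divide_less_eq)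
    with M(1) show ?thesis by linarith
  qed
  with M(1) that show thesis by blast
qed

section \<open>Boundedness of the solution and of the forcing term\<close>

text \<open>
  The invariant \<open>\<bar>x j\<bar> \<le> C\<close> reproduces itself as soon as \<open>C\<close> dominates
  \<open>x 0\<close> and \<open>a + C / 2 \<le> C\<close>.
\<close>

lemma bounded_if_half_contracting:
  fixes x :: "nat \<Rightarrow> real"
  assumes step: "\<And>n C. (\<And>j. j \<le> n \<Longrightarrow> \<bar>x j\<bar> \<le> C) \<Longrightarrow> \<bar>x (Suc n)\<bar> \<le> a + C / 2"
  shows "\<bar>x n\<bar> \<le> max \<bar>x 0\<bar> (2 * a)"
proof (induction n rule: less_induct)
  case (less n)
  show ?case
  proof (cases n)
    case (Suc p)
    have "\<bar>x (Suc p)\<bar> \<le> a + max \<bar>x 0\<bar> (2 * a) / 2"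
      using less.IH Suc by (intro step) auto
    with Suc show ?thesis by simp
  qed simp
qed

lemma solution_bounded_if_forcing_bounded:
  fixes f :: "real \<Rightarrow> real" and k H x :: "nat \<Rightarrow> real"
  assumes "continuous_on UNIV f" "((\<lambda>y. f y / y) \<longlongrightarrow> 0) at_infinity"
    and k: "summable (\<lambda>j. \<bar>k j\<bar>)"
    and rec: "\<And>n. x (n + 1) = H (n + 1) + (\<Sum>j=0..n. k (n - j) * f (x j))"
    and H: "\<And>n. 1 \<le> n \<Longrightarrow> \<bar>H n\<bar> \<le> A"
  shows "\<exists>B. \<forall>n. \<bar>x n\<bar> \<le> B"
proof -
  define K where "K = (\<Sum>j. \<bar>k j\<bar>)"
  have "0 \<le> K" unfolding K_def using k by (intro suminf_nonneg) auto
  \<comment> \<open>The summand 1 keeps the denominator positive when \<open>k\<close> vanishes.\<close>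
  define \<epsilon> where "\<epsilon> = 1 / (2 * (K + 1))"
  have "0 < \<epsilon>" and small: "K * \<epsilon> \<le> 1 / 2"
    using \<open>0 \<le> K\<close> by (auto simp: \<epsilon>_def field_simps)
  obtain M where M: "0 \<le> M" "\<And>y. \<bar>f y\<bar> \<le> M + \<epsilon> * \<bar>y\<bar>"
    using sublinear_affine_bound[OF assms(1,2) \<open>0 < \<epsilon>\<close>] by blast
  have step: "\<bar>x (Suc n)\<bar> \<le> (A + K * M) + C / 2"
    if C: "\<And>j. j \<le> n \<Longrightarrow> \<bar>x j\<bar> \<le> C" for n C
  proof -
    have "0 \<le> C" using C[of 0] by linarith
    have "\<bar>f (x j)\<bar> \<le> M + \<epsilon> * C" if "j \<le> n" for j
      using M(2)[of "x j"] mult_left_mono[OF C[OF that], of \<epsilon>] \<open>0 < \<epsilon>\<close> by linarith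
    then have "\<bar>\<Sum>j=0..n. k (n - j) * f (x j)\<bar> \<le> K * (M + \<epsilon> * C)"
      unfolding K_def by (intro abs_convolution_le[OF k])
    also have "\<dots> = K * M + (K * \<epsilon>) * C" by (simp add: algebra_simps)
    also have "\<dots> \<le> K * M + C / 2"
      using mult_right_mono[OF small \<open>0 \<le> C\<close>] by simp
    finally show ?thesis using rec[of n] H[of "n + 1"] by auto
  qed
  have "\<bar>x n\<bar> \<le> max \<bar>x 0\<bar> (2 * (A + K * M))" for n
    by (rule bounded_if_half_contracting) (rule step)
  then show ?thesis by blast
qed

lemma forcing_bounded_if_solution_bounded:
  fixes f :: "real \<Rightarrow> real" and k H x :: "nat \<Rightarrow> real"
  assumes "continuous_on UNIV f"
    and k: "summable (\<lambda>j. \<bar>k j\<bar>)"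
    and rec: "\<And>n. x (n + 1) = H (n + 1) + (\<Sum>j=0..n. k (n - j) * f (x j))"
    and x: "\<And>n. \<bar>x n\<bar> \<le> B"
  shows "\<exists>A. \<forall>n\<ge>1. \<bar>H n\<bar> \<le> A"
proof -
  obtain M where M: "\<And>y. \<bar>y\<bar> \<le> B \<Longrightarrow> \<bar>f y\<bar> \<le> M"
    using continuous_bounded_on_interval[OF assms(1), of B] by blast
  have "\<bar>H (n + 1)\<bar> \<le> B + (\<Sum>j. \<bar>k j\<bar>) * M" for n
  proof -
    have "\<bar>\<Sum>j=0..n. k (n - j) * f (x j)\<bar> \<le> (\<Sum>j. \<bar>k j\<bar>) * M"
      by (rule abs_convolution_le[OF k]) (simp add: M x)
    with rec[of n] x[of "n + 1"] show ?thesis by linarith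
  qed
  then have "\<bar>H n\<bar> \<le> B + (\<Sum>j. \<bar>k j\<bar>) * M" if "1 \<le> n" for n
    using that by (metis le_add_diff_inverse2)
  then show ?thesis by blast
qed

theorem theorem1:
  fixes f :: "real \<Rightarrow> real" and k H x :: "nat \<Rightarrow> real" and \<xi> :: real
  assumes f_cont: "continuous_on UNIV f"
    and f_sublinear: "((\<lambda>y. f y / y) \<longlongrightarrow> 0) at_infinity"
    and k_summable: "summable (\<lambda>j. \<bar>k j\<bar>)"
    and x_0: "x 0 = \<xi>"
    and x_Suc: "\<And>n. x (n + 1) = H (n + 1) + (\<Sum>j=0..n. k (n - j) * f (x j))"
  shows "((\<exists>L\<in>{0..}. running_max_abs 1 H \<longlonglongrightarrow> L) \<longrightarrow>
           (\<exists>M\<in>{0..}. running_max_abs 0 x \<longlonglongrightarrow> M))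
       \<and> (filterlim (running_max_abs 1 H) at_top sequentially \<longrightarrow>
           filterlim (running_max_abs 0 x) at_top sequentially)"
proof -
  have "(\<exists>A. \<forall>n\<ge>1. \<bar>H n\<bar> \<le> A) \<longleftrightarrow> (\<exists>B. \<forall>n\<ge>0. \<bar>x n\<bar> \<le> B)"
    using solution_bounded_if_forcing_bounded[OF f_cont f_sublinear k_summable x_Suc]
      forcing_bounded_if_solution_bounded[OF f_cont k_summable x_Suc]
    by (metis le0)
  then show ?thesis
    unfolding running_max_abs_converges_iff running_max_abs_at_top_iff by blast
qed

end
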